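(* Let $v$ be a value function satisfying continuity, monotonicity in money-only choices, and non-satiation in money (all defined in the context), and let $$\Delta=\sup_{X,Y,Y'}\big(P_B(X|Y)-P_S(X|Y')\big)$$ be the largest price differential between the buying and the selling price of any bundle. If $\Delta=0$, then the choices satisfy the weak axiom of revealed preference (WARP), there is a utility representation $P(\cdot)$ for the choices with $P(X)=P_B(X|0)$, and this utility representation is additive, satisfying $P(X+Y)=P(X)+P(Y)$ for all bundles $X,Y$.
   Context: Domain of choice: an agent faces $i\ge 1$ simultaneous choices from choice sets $S_i$. Each $S_i$ has at most $N$ options, for some fixed but finite $N$. Each option $x\in S_i$ is a bounded random amount of $n+1$ goods: the first $n\ge 0$ are consumption goods and the $(n+1)$st good is money. So each option is a bounded random variable over $\mathbb{R}^{n+1}$; the space of these is denoted $\mathbb{X}$, and bundles $X,Y,Y',Z$ below are elements of it. For $m\in\mathbb{R}$, $m$ also denotes the bundle consisting only of the sure amount of money $m$; thus $X-m$ is $X$ with $m$ subtracted from its money coordinate, and $0$ is the zero bundle. Value function: when choosing directly over final outcomes from a set $S$ of possible outcomes, the agent's choices are derived by maximizing a value function $v(x|S)$ over $x\in S$; write $C(S)=\arg\max_{x\in S}v(x|S)$ for the set of options chosen from $S$. Assumptions: (i) Continuity: $v(\cdot|S)$ is continuous in $x$ and $S$; formally, with $S_0=S\setminus\{x\}$, $v(x|S_0\cup\{x\})$ is continuous in $x$ and $S_0$. (ii) Monotonicity in money-only choices: if $S=\{m_1,\dots,m_k\}$ is a choice between sure monetary amounts, then $m_i>m_j\iff v(m_i|S)>v(m_j|S)$.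 (iii) Non-satiation in money (adding or subtracting sufficiently large sums of money from an option makes it eventually the only chosen option, or not chosen): for any $S$ and any $X\in S$, writing $S^{(m)}=(S\setminus\{X\})\cup\{X-m\}$, there is some $m_B$ such that only $X-m$ is chosen from $S^{(m)}$ for all $m<m_B$, and some $m_S$ such that $X-m$ is never chosen from $S^{(m)}$ for any $m>m_S$. Prices: for bundles $X,Y$, a set $S$ not containing $Y$, and $m\in\mathbb{R}$, let $S_m=S\cup\{Y,\,Y+X-m\}$. The buying price of $X$ on top of $Y$ is $$P_B(X|Y)=\sup\{m:\ \exists S \text{ with } \{Y\}\cap S=\varnothing \text{ s.t. } v(Y+X-m|S_m)\ge \max_{Z\in S\cup\{Y\}}v(Z|S_m)\},$$ and the selling price is $$P_S(X|Y)=\inf\{m:\ \exists S \text{ with } \{Y\}\cap S=\varnothing \text{ s.t. } v(Y|S_m)\ge \max_{Z\in S_m}v(Z|S_m)\}.$$ WARP: there are no $X,Y\in S\cap S'$ with $X\in C(S)$, $Y\in C(S')$ and $X\notin C(S')$. A utility representation for the choices is a function $P$ on bundles such that the options chosen from a choice set are those maximizing $P$ over it.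
   Formalization: Choice sets of at least three options are allowed (N at least 3 or unbounded), since additivity can fail for N=2; and the "never chosen" half of non-satiation is not required when S={X}, where the only option is always chosen. *)

theory Defs
  imports "HOL-Probability.Probability" "HOL-Library.Function_Algebras"
begin

text \<open>
  The type \<open>'g\<close> indexes the \<open>n + 1 \<ge> 1\<close> goods, one of which, \<open>money\<close>, is singled out. Bundles are
  identified when they agree on the sample space; hence they are normalised to vanish off it.
  Addition and subtraction of bundles are pointwise (\<open>Function_Algebras\<close>).
\<close>

definition bundles :: "'w measure \<Rightarrow> ('w \<Rightarrow> real ^ 'g) set" where
  "bundles M = {X \<in> borel_measurable M.
     bounded (X ` space M) \<and> (\<forall>w. w \<notin> space M \<longrightarrow> X w = 0)}"

definition sure :: "'w measure \<Rightarrow> 'g \<Rightarrow> real \<Rightarrow> 'w \<Rightarrow> real ^ 'g" where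
  "sure M money m = (\<lambda>w. if w \<in> space M then axis money m else 0)"

text \<open>\<open>N = \<infinity>\<close> admits all finite nonempty choice sets.\<close>

definition menus :: "'w measure \<Rightarrow> enat \<Rightarrow> ('w \<Rightarrow> real ^ 'g) set set" where
  "menus M N = {S. S \<subseteq> bundles M \<and> finite S \<and> S \<noteq> {} \<and> enat (card S) \<le> N}"

definition argmax_set :: "('a \<Rightarrow> real) \<Rightarrow> 'a set \<Rightarrow> 'a set" where
  "argmax_set f S = {x. is_arg_max f (\<lambda>y. y \<in> S) x}"

definition choice :: "('a \<Rightarrow> 'a set \<Rightarrow> real) \<Rightarrow> 'a set \<Rightarrow> 'a set" where
  "choice v S = argmax_set (\<lambda>x. v x S) S"

definition sup_dist :: "'w measure \<Rightarrow> ('w \<Rightarrow> real ^ 'g) \<Rightarrow> ('w \<Rightarrow> real ^ 'g) \<Rightarrow> real" where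
  "sup_dist M X Y = (SUP w\<in>space M. dist (X w) (Y w))"

text \<open>
  For finite sets this says that the Hausdorff distance induced by \<open>sup_dist\<close> is less than \<open>d\<close>;
  the empty set is at infinite distance from every nonempty set.
\<close>

definition hausdorff_less ::
  "'w measure \<Rightarrow> real \<Rightarrow> ('w \<Rightarrow> real ^ 'g) set \<Rightarrow> ('w \<Rightarrow> real ^ 'g) set \<Rightarrow> bool" where
  "hausdorff_less M d A B \<longleftrightarrow>
     (\<forall>X\<in>A. \<exists>Y\<in>B. sup_dist M X Y < d) \<and> (\<forall>Y\<in>B. \<exists>X\<in>A. sup_dist M X Y < d)"

text \<open>
  Joint continuity of \<open>(x, T) \<mapsto> v(x | T \<union> {x})\<close> at every pair with \<open>x \<notin> T\<close>. The uniform distance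
  is the strongest of the usual ones on bounded random variables, so this is the weakest such
  requirement: continuity for \<open>L\<^sup>p\<close> convergence or convergence in probability or law implies it.
\<close>

definition continuous_value ::
  "'w measure \<Rightarrow> enat \<Rightarrow> (('w \<Rightarrow> real ^ 'g) \<Rightarrow> ('w \<Rightarrow> real ^ 'g) set \<Rightarrow> real) \<Rightarrow> bool" where
  "continuous_value M N v \<longleftrightarrow>
     (\<forall>x T. x \<notin> T \<and> insert x T \<in> menus M N \<longrightarrow>
       (\<forall>e>0. \<exists>d>0. \<forall>x' T'. x' \<notin> T' \<and> insert x' T' \<in> menus M N \<and>
          sup_dist M x x' < d \<and> hausdorff_less M d T T' \<longrightarrow>
          \<bar>v x' (insert x' T') - v x (insert x T)\<bar> < e))"

definition money_monotone ::
  "'w measure \<Rightarrow> 'g \<Rightarrow> enat \<Rightarrow> (('w \<Rightarrow> real ^ 'g) \<Rightarrow> ('w \<Rightarrow> real ^ 'g) set \<Rightarrow> real) \<Rightarrow> bool" where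
  "money_monotone M money N v \<longleftrightarrow>
     (\<forall>A. sure M money ` A \<in> menus M N \<longrightarrow>
       (\<forall>a\<in>A. \<forall>b\<in>A. a > b \<longleftrightarrow>
          v (sure M money a) (sure M money ` A) > v (sure M money b) (sure M money ` A)))"

definition pay ::
  "'w measure \<Rightarrow> 'g \<Rightarrow> ('w \<Rightarrow> real ^ 'g) set \<Rightarrow> ('w \<Rightarrow> real ^ 'g) \<Rightarrow> real \<Rightarrow> ('w \<Rightarrow> real ^ 'g) set" where
  "pay M money S X m = (S - {X}) \<union> {X - sure M money m}"

text \<open>
  The second half must exclude \<open>S = {X}\<close>: the only element of a singleton is always chosen.
\<close>

definition money_nonsatiated ::
  "'w measure \<Rightarrow> 'g \<Rightarrow> enat \<Rightarrow> (('w \<Rightarrow> real ^ 'g) \<Rightarrow> ('w \<Rightarrow> real ^ 'g) set \<Rightarrow> real) \<Rightarrow> bool" where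
  "money_nonsatiated M money N v \<longleftrightarrow>
     (\<forall>S\<in>menus M N. \<forall>X\<in>S.
       (\<exists>mB. \<forall>m<mB. choice v (pay M money S X m) = {X - sure M money m}) \<and>
       (S \<noteq> {X} \<longrightarrow>
         (\<exists>mS. \<forall>m>mS. X - sure M money m \<notin> choice v (pay M money S X m))))"

definition offer ::
  "'w measure \<Rightarrow> 'g \<Rightarrow> ('w \<Rightarrow> real ^ 'g) set \<Rightarrow> ('w \<Rightarrow> real ^ 'g) \<Rightarrow> ('w \<Rightarrow> real ^ 'g) \<Rightarrow> real
     \<Rightarrow> ('w \<Rightarrow> real ^ 'g) set" where
  "offer M money S X Y m = S \<union> {Y, Y + X - sure M money m}"

text \<open>Prices of \<open>X\<close> on top of \<open>Y\<close>; \<open>S\<close> may be empty.\<close>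

definition buying_price ::
  "'w measure \<Rightarrow> 'g \<Rightarrow> enat \<Rightarrow> (('w \<Rightarrow> real ^ 'g) \<Rightarrow> ('w \<Rightarrow> real ^ 'g) set \<Rightarrow> real)
     \<Rightarrow> ('w \<Rightarrow> real ^ 'g) \<Rightarrow> ('w \<Rightarrow> real ^ 'g) \<Rightarrow> ereal" where
  "buying_price M money N v X Y =
     Sup {ereal m | m. \<exists>S. {Y} \<inter> S = {} \<and> offer M money S X Y m \<in> menus M N \<and>
       v (Y + X - sure M money m) (offer M money S X Y m)
         \<ge> (MAX Z\<in>S \<union> {Y}. v Z (offer M money S X Y m))}"

definition selling_price ::
  "'w measure \<Rightarrow> 'g \<Rightarrow> enat \<Rightarrow> (('w \<Rightarrow> real ^ 'g) \<Rightarrow> ('w \<Rightarrow> real ^ 'g) set \<Rightarrow> real)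
     \<Rightarrow> ('w \<Rightarrow> real ^ 'g) \<Rightarrow> ('w \<Rightarrow> real ^ 'g) \<Rightarrow> ereal" where
  "selling_price M money N v X Y =
     Inf {ereal m | m. \<exists>S. {Y} \<inter> S = {} \<and> offer M money S X Y m \<in> menus M N \<and>
       v Y (offer M money S X Y m)
         \<ge> (MAX Z\<in>offer M money S X Y m. v Z (offer M money S X Y m))}"

text \<open>
  No \<open>\<infinity> - \<infinity>\<close> arises for \<open>N \<ge> 2\<close>: by non-satiation buying prices exceed \<open>-\<infinity>\<close> and selling
  prices are below \<open>\<infinity>\<close>.
\<close>

definition max_price_gap ::
  "'w measure \<Rightarrow> 'g \<Rightarrow> enat \<Rightarrow> (('w \<Rightarrow> real ^ 'g) \<Rightarrow> ('w \<Rightarrow> real ^ 'g) set \<Rightarrow> real) \<Rightarrow> ereal" where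
  "max_price_gap M money N v =
     (SUP (X, Y, Y') \<in> bundles M \<times> bundles M \<times> bundles M.
        buying_price M money N v X Y - selling_price M money N v X Y')"

definition warp :: "'a set set \<Rightarrow> ('a set \<Rightarrow> 'a set) \<Rightarrow> bool" where
  "warp D C \<longleftrightarrow>
     \<not> (\<exists>S\<in>D. \<exists>S'\<in>D. \<exists>X\<in>S \<inter> S'. \<exists>Y\<in>S \<inter> S'. X \<in> C S \<and> Y \<in> C S' \<and> X \<notin> C S')"

definition utility_representation ::
  "'a set set \<Rightarrow> ('a set \<Rightarrow> 'a set) \<Rightarrow> ('a \<Rightarrow> real) \<Rightarrow> bool" where
  "utility_representation D C P \<longleftrightarrow> (\<forall>S\<in>D. C S = argmax_set P S)"

end

theory Submission imports Defs
begin

text \<open>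
  Let \<open>W\<close> be revealed weakly preferred to \<open>Y\<close> if \<open>W\<close> is chosen from some menu containing \<open>Y\<close>. The
  buying price of \<open>X\<close> on top of \<open>Y\<close> is the supremum of the \<open>m\<close> for which \<open>Y + X - m\<close> is revealed
  preferred to \<open>Y\<close>, and the selling price is the infimum of the \<open>m\<close> for which \<open>Y\<close> is revealed
  preferred to \<open>Y + X - m\<close>. Something is chosen from \<open>{Y, Y + X - m}\<close>, so the buying price is never
  below the selling price on top of the same \<open>Y\<close>. If the gap is zero, all prices of \<open>X\<close> therefore
  agree with one number \<open>P X\<close>. Choices from two-element menus give \<open>P (X + m) = P X + m\<close> and
  \<open>P (- X) = - P X\<close>, and the menu \<open>{0, X, X + Y}\<close> gives superadditivity, hence additivity. Chosen
  options maximise \<open>P\<close>. Conversely, if a maximiser \<open>Y\<close> of \<open>P\<close> were not chosen, it would by continuity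
  still not be chosen after adding a little money to it, although it is then the only maximiser.
\<close>

definition revealed ::
  "'w measure \<Rightarrow> enat \<Rightarrow> (('w \<Rightarrow> real ^ 'g) \<Rightarrow> ('w \<Rightarrow> real ^ 'g) set \<Rightarrow> real)
     \<Rightarrow> ('w \<Rightarrow> real ^ 'g) \<Rightarrow> ('w \<Rightarrow> real ^ 'g) \<Rightarrow> bool" where
  "revealed M N v W Y \<longleftrightarrow> (\<exists>T\<in>menus M N. W \<in> choice v T \<and> Y \<in> T)"

section \<open>Maximisers and chosen options\<close>

lemma mem_argmax_set: "x \<in> argmax_set f S \<longleftrightarrow> x \<in> S \<and> (\<forall>y\<in>S. f y \<le> f x)"
  by (auto simp: argmax_set_def is_arg_max_def not_less)

lemma mem_choice: "x \<in> choice v S \<longleftrightarrow> x \<in> S \<and> (\<forall>y\<in>S. v y S \<le> v x S)"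
  by (simp add: choice_def mem_argmax_set)

lemma choice_nonempty:
  assumes "finite S" "S \<noteq> {}"
  shows "choice v S \<noteq> {}"
proof -
  obtain x where "x \<in> S" "v x S = (MAX y\<in>S. v y S)"
    using obtains_MAX[OF assms] by metis
  then have "x \<in> choice v S"
    using assms by (auto simp: mem_choice)
  then show ?thesis
    by blast
qed

section \<open>The group of bundles and its sure amounts of money\<close>

lemma bundles_zero [simp]: "0 \<in> bundles M"
  by (auto simp: bundles_def zero_fun_def bounded_iff)

lemma bundles_add: "X \<in> bundles M \<Longrightarrow> Y \<in> bundles M \<Longrightarrow> X + Y \<in> bundles M"
  using bounded_plus_comp[of X "space M" Y]
  by (auto simp: bundles_def plus_fun_def)

lemma bundles_diff: "X \<in> bundles M \<Longrightarrow> Y \<in> bundles M \<Longrightarrow> X - Y \<in> bundles M"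
  using bounded_minus_comp[of X "space M" Y]
  by (auto simp: bundles_def fun_diff_def)

lemma bundles_uminus: "X \<in> bundles M \<Longrightarrow> - X \<in> bundles M"
  using bundles_diff[of 0 M X] by simp

lemma bundles_sure: "sure M money m \<in> bundles M"
proof -
  have "bounded (sure M money m ` space M)"
    by (rule finite_imp_bounded, rule finite_subset[of _ "{axis money m}"]) (auto simp: sure_def)
  moreover have "sure M money m \<in> borel_measurable M"
    unfolding sure_def by simp
  ultimately show ?thesis
    by (simp add: bundles_def sure_def)
qed

lemmas bundles_closed = bundles_add bundles_diff bundles_uminus bundles_sure

lemma sure_0 [simp]: "sure M money 0 = 0"
  by (auto simp: sure_def fun_eq_iff axis_def vec_eq_iff)

lemma sure_add: "sure M money (a + b) = sure M money a + sure M money b"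
  by (auto simp: sure_def fun_eq_iff axis_def vec_eq_iff)

lemma sure_minus: "sure M money (- a) = - sure M money a"
  by (auto simp: sure_def fun_eq_iff axis_def vec_eq_iff)

lemma sure_diff: "sure M money (a - b) = sure M money a - sure M money b"
  by (auto simp: sure_def fun_eq_iff axis_def vec_eq_iff)

text \<open>Nonemptiness matters: over an empty sample space \<open>sup_dist\<close> would be the
  unspecified supremum of the empty set of reals.\<close>

lemma sup_dist_self:
  assumes "space M \<noteq> {}"
  shows "sup_dist M X X = 0"
  using assms by (simp add: sup_dist_def)

lemma norm_axis_real: "norm (axis i m :: real ^ 'n::finite) = \<bar>m\<bar>"
  by (simp add: norm_eq_sqrt_inner inner_axis_axis)

lemma sup_dist_add_sure:
  fixes money :: "'g::finite"
  assumes "space M \<noteq> {}"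
  shows "sup_dist M X (X + sure M money m) = \<bar>m\<bar>"
proof -
  have "(\<lambda>w. dist (X w) ((X + sure M money m) w)) ` space M = (\<lambda>w. \<bar>m\<bar>) ` space M"
    by (rule image_cong) (auto simp: sure_def dist_norm norm_axis_real)
  then show ?thesis
    using assms unfolding sup_dist_def by simp
qed

section \<open>Prices in terms of revealed preference\<close>

text \<open>Requiring \<open>Y\<close> to lie outside \<open>S\<close> is no restriction: any menu
  \<open>T\<close> containing both options is the offer built from \<open>T - {Y}\<close>.\<close>

lemma offer_iff_revealed:
  "(\<exists>S. {Y} \<inter> S = {} \<and> offer M money S X Y m \<in> menus M N \<and> W \<in> choice v (offer M money S X Y m))
     \<longleftrightarrow> (\<exists>T\<in>menus M N. W \<in> choice v T \<and> {Y, Y + X - sure M money m} \<subseteq> T)" (is "?L = ?R")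
proof
  assume ?L
  then show ?R
    by (auto simp: offer_def)
next
  assume ?R
  then obtain T where T: "T \<in> menus M N" "W \<in> choice v T" "{Y, Y + X - sure M money m} \<subseteq> T"
    by blast
  then have "offer M money (T - {Y}) X Y m = T"
    by (auto simp: offer_def)
  then show ?L
    using T by (intro exI[of _ "T - {Y}"]) auto
qed

text \<open>The maximum in the definition leaves out the bought option unless it lies in
  \<open>S\<close> or equals \<open>Y\<close>, but comparing that option with itself adds no
  constraint.\<close>

lemma buying_price_revealed:
  "buying_price M money N v X Y = Sup {ereal m | m. revealed M N v (Y + X - sure M money m) Y}"
proof -
  have "v (Y + X - sure M money m) (offer M money S X Y m)
          \<ge> (MAX Z\<in>S \<union> {Y}. v Z (offer M money S X Y m))
        \<longleftrightarrow> Y + X - sure M money m \<in> choice v (offer M money S X Y m)"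
    if "offer M money S X Y m \<in> menus M N" for S m
  proof -
    have "finite S"
      using that by (auto simp: menus_def offer_def)
    then show ?thesis
      by (subst Max_le_iff) (auto simp: mem_choice offer_def)
  qed
  then have "(\<exists>S. {Y} \<inter> S = {} \<and> offer M money S X Y m \<in> menus M N \<and>
       v (Y + X - sure M money m) (offer M money S X Y m)
         \<ge> (MAX Z\<in>S \<union> {Y}. v Z (offer M money S X Y m)))
      \<longleftrightarrow> revealed M N v (Y + X - sure M money m) Y" for m
    using offer_iff_revealed[of Y M money X m N "Y + X - sure M money m" v]
    by (auto simp: revealed_def mem_choice)
  then show ?thesis
    unfolding buying_price_def by simp
qed

lemma selling_price_revealed:
  "selling_price M money N v X Y = Inf {ereal m | m. revealed M N v Y (Y + X - sure M money m)}"
proof -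
  have "v Y (offer M money S X Y m)
          \<ge> (MAX Z\<in>offer M money S X Y m. v Z (offer M money S X Y m))
        \<longleftrightarrow> Y \<in> choice v (offer M money S X Y m)"
    if "offer M money S X Y m \<in> menus M N" for S m
  proof -
    have "finite (offer M money S X Y m)" "offer M money S X Y m \<noteq> {}"
      using that by (auto simp: menus_def)
    then show ?thesis
      by (subst Max_le_iff) (auto simp: mem_choice offer_def)
  qed
  then have "(\<exists>S. {Y} \<inter> S = {} \<and> offer M money S X Y m \<in> menus M N \<and>
       v Y (offer M money S X Y m)
         \<ge> (MAX Z\<in>offer M money S X Y m. v Z (offer M money S X Y m)))
      \<longleftrightarrow> revealed M N v Y (Y + X - sure M money m)" for m
    using offer_iff_revealed[of Y M money X m N Y v]
    by (auto simp: revealed_def mem_choice)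
  then show ?thesis
    unfolding selling_price_def by simp
qed

section \<open>Continuity of the value function\<close>

lemma hausdorff_less_refl:
  assumes "space M \<noteq> {}" "0 < d"
  shows "hausdorff_less M d A A"
proof -
  have "sup_dist M X X < d" for X :: "'a \<Rightarrow> real ^ 'b"
    using assms by (simp add: sup_dist_self)
  then show ?thesis
    unfolding hausdorff_less_def by blast
qed

lemma hausdorff_less_insert:
  "sup_dist M X X' < d \<Longrightarrow> hausdorff_less M d A B \<Longrightarrow> hausdorff_less M d (insert X A) (insert X' B)"
  unfolding hausdorff_less_def by blast

lemma continuous_valueD:
  assumes "continuous_value M N v" "x \<notin> T" "insert x T \<in> menus M N" "e > 0"
  obtains d where "d > 0"
    "\<And>x' T'. x' \<notin> T' \<Longrightarrow> insert x' T' \<in> menus M N \<Longrightarrow> sup_dist M x x' < d \<Longrightarrow>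
       hausdorff_less M d T T' \<Longrightarrow> \<bar>v x' (insert x' T') - v x (insert x T)\<bar> < e"
proof -
  have "\<exists>d>0. \<forall>x' T'. x' \<notin> T' \<and> insert x' T' \<in> menus M N \<and>
      sup_dist M x x' < d \<and> hausdorff_less M d T T' \<longrightarrow>
      \<bar>v x' (insert x' T') - v x (insert x T)\<bar> < e"
    using assms(1)[unfolded continuous_value_def, rule_format, OF conjI, OF assms(2,3,4)] by simp
  then show thesis
    using that by metis
qed

section \<open>Zero gap: one price for each bundle\<close>

locale zero_price_gap = prob_space M for M :: "'w measure" +
  fixes money :: "'g::finite"
    and N :: enat
    and v :: "('w \<Rightarrow> real ^ 'g) \<Rightarrow> ('w \<Rightarrow> real ^ 'g) set \<Rightarrow> real"
  assumes three_le: "3 \<le> N"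
    and continuous: "continuous_value M N v"
    and nonsatiated: "money_nonsatiated M money N v"
    and gap_zero: "max_price_gap M money N v = 0"
begin

abbreviation (input) cash :: "real \<Rightarrow> 'w \<Rightarrow> real ^ 'g" where
  "cash \<equiv> sure M money"

abbreviation (input) rev_pref where
  "rev_pref \<equiv> revealed M N v"

lemma menu_le_3:
  assumes "S \<subseteq> bundles M" "finite S" "S \<noteq> {}" "card S \<le> 3"
  shows "S \<in> menus M N"
proof -
  have "enat (card S) \<le> enat 3"
    using assms by simp
  also have "\<dots> \<le> N"
    using three_le by (simp add: numeral_eq_enat)
  finally show ?thesis
    using assms by (simp add: menus_def)
qed

text \<open>Supplies the menu \<open>{0, X, X + Y}\<close> behind superadditivity. Coinciding
  entries only lower the cardinality.\<close>

lemma menu_triple: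
  assumes "X \<in> bundles M" "Y \<in> bundles M" "Z \<in> bundles M"
  shows "{X, Y, Z} \<in> menus M N"
proof (rule menu_le_3)
  show "card {X, Y, Z} \<le> 3"
    using card_length[of "[X, Y, Z]"] by simp
qed (use assms in simp_all)

lemma menu_pair:
  assumes "X \<in> bundles M" "Y \<in> bundles M"
  shows "{X, Y} \<in> menus M N"
  using menu_triple[OF assms(1,1,2)] by simp

lemma menu_choice_nonempty: "S \<in> menus M N \<Longrightarrow> choice v S \<noteq> {}"
  by (rule choice_nonempty) (auto simp: menus_def)

lemma rev_pref_total:
  assumes "X \<in> bundles M" "Y \<in> bundles M"
  shows "rev_pref X Y \<or> rev_pref Y X"
proof -
  have menu: "{X, Y} \<in> menus M N"
    using assms by (rule menu_pair)
  then obtain W where "W \<in> choice v {X, Y}"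
    using menu_choice_nonempty by blast
  moreover from this have "W = X \<or> W = Y"
    by (auto simp: mem_choice)
  ultimately show ?thesis
    using menu unfolding revealed_def by blast
qed

lemma cash_1_neq_0: "cash 1 \<noteq> 0"
proof -
  obtain w where "w \<in> space M"
    using not_empty by auto
  then have "cash 1 w $ money \<noteq> 0 $ money"
    by (simp add: sure_def axis_def)
  then show ?thesis
    by (metis zero_fun_apply)
qed

lemma price_sets_nonempty:
  assumes X: "X \<in> bundles M" and Y: "Y \<in> bundles M"
  shows "\<exists>m. rev_pref (Y + X - cash m) Y" "\<exists>m. rev_pref Y (Y + X - cash m)"
proof -
  \<comment> \<open>For \<open>X = 0\<close> the bundle \<open>Y + X\<close> equals \<open>Y\<close>
    and the menu would be a singleton, about which the second half of non-satiation is silent.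
    Adding one unit of money separates the two options.\<close>
  define c :: real where "c = (if X = 0 then 1 else 0)"
  define Z where "Z = Y + X + cash c"
  have ne: "Z \<noteq> Y"
    using cash_1_neq_0 by (auto simp: Z_def c_def add.assoc)
  have Z: "Z \<in> bundles M"
    using X Y by (simp add: Z_def bundles_closed)
  have pay: "pay M money {Y, Z} Z m = {Y, Z - cash m}" for m
    using ne by (auto simp: pay_def)
  have shift: "Z - cash m = Y + X - cash (m - c)" for m
    by (simp add: Z_def sure_diff algebra_simps)
  have menu: "{Y, Z - cash m} \<in> menus M N" for m
    using Y Z by (intro menu_pair bundles_closed)
  have "Z \<in> {Y, Z}" "{Y, Z} \<noteq> {Z}"
    using ne by auto
  then have "(\<exists>mB. \<forall>m<mB. choice v {Y, Z - cash m} = {Z - cash m}) \<and>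
    (\<exists>mS. \<forall>m>mS. Z - cash m \<notin> choice v {Y, Z - cash m})"
    using nonsatiated menu_pair[OF Y Z] unfolding money_nonsatiated_def pay[symmetric] by blast
  then obtain mB mS where
    mB: "\<And>m. m < mB \<Longrightarrow> choice v {Y, Z - cash m} = {Z - cash m}" and
    mS: "\<And>m. m > mS \<Longrightarrow> Z - cash m \<notin> choice v {Y, Z - cash m}"
    by blast
  have "Z - cash (mB - 1) \<in> choice v {Y, Z - cash (mB - 1)}"
    using mB[of "mB - 1"] by simp
  then have "rev_pref (Z - cash (mB - 1)) Y"
    using menu[of "mB - 1"] unfolding revealed_def by blast
  then show "\<exists>m. rev_pref (Y + X - cash m) Y"
    unfolding shift by blast
  have "Y \<in> choice v {Y, Z - cash (mS + 1)}"
    using mS[of "mS + 1"] menu_choice_nonempty[OF menu[of "mS + 1"]]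
    by (auto simp: mem_choice)
  then have "rev_pref Y (Z - cash (mS + 1))"
    using menu[of "mS + 1"] unfolding revealed_def by blast
  then show "\<exists>m. rev_pref Y (Y + X - cash m)"
    unfolding shift by blast
qed

text \<open>\<open>real_of_ereal\<close> sends infinite values to 0; \<open>prices_eq\<close> shows
  that this default never occurs on bundles.\<close>

definition price :: "('w \<Rightarrow> real ^ 'g) \<Rightarrow> real" where
  "price X = real_of_ereal (buying_price M money N v X 0)"

lemma prices_eq:
  assumes X: "X \<in> bundles M" and Y: "Y \<in> bundles M"
  shows "buying_price M money N v X Y = ereal (price X)"
    and "selling_price M money N v X Y = ereal (price X)"
proof -
  let ?B = "buying_price M money N v X" and ?S = "selling_price M money N v X"
  have B: "?B Z \<noteq> -\<infinity>" if Z: "Z \<in> bundles M" for Z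
  proof -
    obtain m where "rev_pref (Z + X - cash m) Z"
      using price_sets_nonempty[OF X Z] by blast
    then have "ereal m \<le> ?B Z"
      unfolding buying_price_revealed by (intro Sup_upper) auto
    then show ?thesis
      by auto
  qed
  have S: "?S Z \<noteq> \<infinity>" if Z: "Z \<in> bundles M" for Z
  proof -
    obtain m where "rev_pref Z (Z + X - cash m)"
      using price_sets_nonempty[OF X Z] by blast
    then have "?S Z \<le> ereal m"
      unfolding selling_price_revealed by (intro Inf_lower) auto
    then show ?thesis
      by auto
  qed
  have gap: "?B Z - ?S Z' \<le> 0" if "Z \<in> bundles M" "Z' \<in> bundles M" for Z Z'
    unfolding gap_zero[symmetric] max_price_gap_def
    by (rule SUP_upper2[of "(X, Z, Z')"]) (use X that in auto)
  \<comment> \<open>A buying price of infinity or a selling price of minus infinity would make the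
    difference infinite, so both prices are finite.\<close>
  have le: "?B Z \<le> ?S Z' \<and> \<bar>?B Z\<bar> \<noteq> \<infinity> \<and> \<bar>?S Z'\<bar> \<noteq> \<infinity>"
    if "Z \<in> bundles M" "Z' \<in> bundles M" for Z Z'
    using gap[OF that] B[OF that(1)] S[OF that(2)]
    by (cases "?B Z"; cases "?S Z'") auto
  \<comment> \<open>At an \<open>m\<close> strictly between the two prices neither option could be
    chosen from the pair.\<close>
  have ge: "?S Z \<le> ?B Z" if Z: "Z \<in> bundles M" for Z
  proof (rule ccontr)
    assume "\<not> ?S Z \<le> ?B Z"
    then have "?B Z < ?S Z"
      by simp
    then obtain m where m: "?B Z < ereal m" "ereal m < ?S Z"
      using ereal_dense2 by blast
    have "Z + X - cash m \<in> bundles M"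
      using X Z by (simp add: bundles_closed)
    then consider "rev_pref (Z + X - cash m) Z" | "rev_pref Z (Z + X - cash m)"
      using rev_pref_total Z by blast
    then show False
    proof cases
      case 1
      then have "ereal m \<le> ?B Z"
        unfolding buying_price_revealed by (intro Sup_upper) auto
      then show False
        using m by simp
    next
      case 2
      then have "?S Z \<le> ereal m"
        unfolding selling_price_revealed by (intro Inf_lower) auto
      then show False
        using m by simp
    qed
  qed
  have 0: "?B 0 = ereal (price X)"
    using le[of 0 0] by (simp add: price_def ereal_real)
  \<comment> \<open>These four inequalities close a cycle, so all the prices in it coincide.\<close>
  have "?B Y \<le> ?S 0" "?S 0 \<le> ?B 0" "?B 0 \<le> ?S Y" "?S Y \<le> ?B Y"
    using le[of Y 0] le[of 0 Y] ge[of 0] ge[of Y] Y by auto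
  then show "?B Y = ereal (price X)" "?S Y = ereal (price X)"
    unfolding 0[symmetric] by order+
qed

text \<open>The base \<open>Y\<close> is arbitrary: comparisons on top of any bundle constrain the
  same number \<open>price X\<close>.\<close>

lemma price_bounds:
  assumes "X \<in> bundles M" "Y \<in> bundles M"
  shows "rev_pref (Y + X - cash m) Y \<Longrightarrow> m \<le> price X"
    and "rev_pref Y (Y + X - cash m) \<Longrightarrow> price X \<le> m"
proof -
  assume "rev_pref (Y + X - cash m) Y"
  then have "ereal m \<le> buying_price M money N v X Y"
    unfolding buying_price_revealed by (intro Sup_upper) auto
  then show "m \<le> price X"
    using prices_eq[OF assms] by simp
next
  assume "rev_pref Y (Y + X - cash m)"
  then have "selling_price M money N v X Y \<le> ereal m"
    unfolding selling_price_revealed by (intro Inf_lower) auto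
  then show "price X \<le> m"
    using prices_eq[OF assms] by simp
qed

text \<open>Choosing \<open>X\<close> over \<open>Y\<close> means buying \<open>X - Y\<close> on top
  of \<open>Y\<close> for nothing, and also declining \<open>Y - X\<close> on top of
  \<open>X\<close> at price 0.\<close>

lemma rev_pref_price:
  assumes "X \<in> bundles M" "Y \<in> bundles M" "rev_pref X Y"
  shows "0 \<le> price (X - Y)" "price (Y - X) \<le> 0"
  using price_bounds(1)[of "X - Y" Y 0] price_bounds(2)[of "Y - X" X 0] assms
  by (simp_all add: bundles_closed)

section \<open>Additivity of the price\<close>

text \<open>\<open>X + cash c\<close> bought for \<open>m + c\<close> is the same bundle as
  \<open>X\<close> bought for \<open>m\<close>. Off the price of \<open>X\<close>, totality decides
  how it compares with 0.\<close>

lemma price_add_cash: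
  assumes X: "X \<in> bundles M"
  shows "price (X + cash c) = price X + c"
proof -
  have X': "X + cash c \<in> bundles M"
    using X by (simp add: bundles_closed)
  have shift: "X + cash c - cash (m + c) = X - cash m" for m
    by (simp add: sure_add)
  have cmp: "rev_pref (X - cash m) 0 \<or> rev_pref 0 (X - cash m)" for m
    using X by (intro rev_pref_total) (auto simp: bundles_closed)
  have "price (X + cash c) - c \<le> m" if "price X < m" for m
  proof -
    have "rev_pref 0 (X - cash m)"
      using cmp[of m] price_bounds(1)[OF X, of 0 m] that by auto
    then show ?thesis
      using price_bounds(2)[OF X', of 0 "m + c"] shift[of m] by simp
  qed
  then have 1: "price (X + cash c) - c \<le> price X"
    by (rule dense_ge)
  have "m \<le> price (X + cash c) - c" if "m < price X" for m
  proof -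
    have "rev_pref (X - cash m) 0"
      using cmp[of m] price_bounds(2)[OF X, of 0 m] that by auto
    then show ?thesis
      using price_bounds(1)[OF X', of 0 "m + c"] shift[of m] by simp
  qed
  then have "price X \<le> price (X + cash c) - c"
    by (rule dense_le)
  with 1 show ?thesis
    by simp
qed

lemma price_diff_cash:
  assumes "X \<in> bundles M"
  shows "price (X - cash c) = price X - c"
  using price_add_cash[OF assms, of "- c"] by (simp add: sure_minus)

lemma price_uminus:
  assumes X: "X \<in> bundles M"
  shows "price (- X) = - price X"
proof -
  have X': "- X \<in> bundles M"
    using X by (rule bundles_uminus)
  define Y where "Y m = X - cash m" for m
  have Y: "Y m \<in> bundles M" for m
    using X by (simp add: Y_def bundles_closed)
  have pY: "price (Y m) = price X - m" for m
    using price_diff_cash[OF X] by (simp add: Y_def)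
  have pY': "price (- Y m) = price (- X) + m" for m
    using price_add_cash[OF X', of m] by (simp add: Y_def)
  \<comment> \<open>Comparing \<open>Y m\<close> with 0 gives the prices of \<open>Y m\<close> and
    \<open>- Y m\<close> opposite weak signs.\<close>
  have "0 \<le> price (Y m) \<and> price (- Y m) \<le> 0 \<or> price (Y m) \<le> 0 \<and> 0 \<le> price (- Y m)" for m
    using rev_pref_total[OF Y[of m] bundles_zero] rev_pref_price[OF Y[of m] bundles_zero]
      rev_pref_price[OF bundles_zero Y[of m]] by auto
  \<comment> \<open>At this \<open>m\<close> both prices equal
    \<open>(price X + price (- X)) / 2\<close>; having opposite weak signs, this number is
    0.\<close>
  from this[of "(price X - price (- X)) / 2"] show ?thesis
    unfolding pY pY' by (auto simp: field_simps)
qed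

lemma price_superadd:
  assumes X: "X \<in> bundles M" and Y: "Y \<in> bundles M"
  shows "price X + price Y \<le> price (X + Y)"
proof (rule field_le_epsilon)
  fix e :: real
  assume e: "0 < e"
  \<comment> \<open>Money is subtracted so that both bundles have the strictly positive price
    \<open>e / 2\<close>, which excludes ties.\<close>
  define X' where "X' = X - cash (price X - e / 2)"
  define Y' where "Y' = Y - cash (price Y - e / 2)"
  have b: "X' \<in> bundles M" "Y' \<in> bundles M" "X' + Y' \<in> bundles M"
    using X Y by (simp_all add: X'_def Y'_def bundles_closed)
  have pos: "price X' = e / 2" "price Y' = e / 2"
    using price_diff_cash X Y by (simp_all add: X'_def Y'_def)
  have menu: "{0, X', X' + Y'} \<in> menus M N"
    using b by (intro menu_triple) auto
  \<comment> \<open>From the triple, 0 cannot be chosen in the presence of \<open>X'\<close>, nor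
    \<open>X'\<close> in the presence of \<open>X' + Y'\<close>: either choice would force a
    nonpositive price on \<open>X'\<close> or \<open>Y'\<close>.\<close>
  have "\<not> rev_pref 0 X'" "\<not> rev_pref X' (X' + Y')"
    using rev_pref_price(2)[of 0 X'] rev_pref_price(2)[of X' "X' + Y'"] b pos e by auto
  moreover obtain W where "W \<in> choice v {0, X', X' + Y'}"
    using menu_choice_nonempty[OF menu] by blast
  moreover from this have "W = 0 \<or> W = X' \<or> W = X' + Y'"
    by (auto simp: mem_choice)
  ultimately have "rev_pref (X' + Y') 0"
    using menu unfolding revealed_def by blast
  then have "0 \<le> price (X' + Y')"
    using rev_pref_price(1)[of "X' + Y'" 0] b by simp
  also have "X' + Y' = (X + Y) - cash (price X + price Y - e)"
    using sure_add[of M money "price X - e / 2" "price Y - e / 2"]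
    by (simp add: X'_def Y'_def algebra_simps)
  also have "price \<dots> = price (X + Y) - (price X + price Y - e)"
    using X Y by (intro price_diff_cash bundles_closed)
  finally show "price X + price Y \<le> price (X + Y) + e"
    by simp
qed

text \<open>Superadditivity at \<open>- X\<close> and \<open>- Y\<close> turns into subadditivity at
  \<open>X\<close> and \<open>Y\<close>, because the price is odd.\<close>

lemma price_add:
  assumes X: "X \<in> bundles M" and Y: "Y \<in> bundles M"
  shows "price (X + Y) = price X + price Y"
proof -
  have "price (- X) + price (- Y) \<le> price (- X + - Y)"
    using X Y by (intro price_superadd bundles_closed)
  also have "- X + - Y = - (X + Y)"
    by (rule minus_add_distrib[symmetric])
  also have "price \<dots> = - price (X + Y)"
    using X Y by (intro price_uminus bundles_closed)
  finally have "price (X + Y) \<le> price X + price Y"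
    unfolding price_uminus[OF X] price_uminus[OF Y] by linarith
  then show ?thesis
    using price_superadd[OF X Y] by simp
qed

section \<open>The price represents the choices\<close>

lemma chosen_maximizes_price:
  assumes T: "T \<in> menus M N" "W \<in> choice v T" "Y \<in> T"
  shows "price Y \<le> price W"
proof -
  have b: "W \<in> bundles M" "Y \<in> bundles M"
    using T by (auto simp: menus_def mem_choice)
  have "rev_pref W Y"
    using T by (auto simp: revealed_def)
  then have "0 \<le> price (W - Y)"
    using rev_pref_price b by blast
  then show ?thesis
    using price_add[of "W - Y" Y] b by (simp add: bundles_closed)
qed

lemma price_maximizer_chosen:
  assumes T: "T \<in> menus M N" and Y: "Y \<in> T" and max: "\<And>Z. Z \<in> T \<Longrightarrow> price Z \<le> price Y"
  shows "Y \<in> choice v T"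
proof (rule ccontr)
  assume notin: "Y \<notin> choice v T"
  obtain W where W: "W \<in> choice v T"
    using menu_choice_nonempty[OF T] by blast
  have WT: "W \<in> T"
    using W by (simp add: mem_choice)
  have WY: "W \<noteq> Y"
    using W notin by blast
  obtain Z where "Z \<in> T" "v Y T < v Z T"
    using notin Y by (auto simp: mem_choice not_le)
  then have lt: "v Y T < v W T"
    using W by (meson mem_choice less_le_trans)
  \<comment> \<open>Half the gap: two values that each move by less than \<open>e\<close> cannot
    swap their order.\<close>
  define e where "e = (v W T - v Y T) / 2"
  have e: "e > 0"
    using lt by (simp add: e_def)
  \<comment> \<open>Continuity is used with two splittings of \<open>T\<close>: at \<open>Y\<close>
    the point moves and the rest \<open>U\<close> stays; at \<open>W\<close> the point stays and the
    rest, which contains \<open>Y\<close>, moves.\<close>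
  define U where "U = T - {Y}"
  define V where "V = T - {Y, W}"
  have TU: "insert Y U = T" and TV: "insert W (insert Y V) = T"
    using Y WT by (auto simp: U_def V_def)
  have "Y \<notin> U"
    by (simp add: U_def)
  then obtain d1 where d1: "d1 > 0"
    "\<And>x' T'. x' \<notin> T' \<Longrightarrow> insert x' T' \<in> menus M N \<Longrightarrow> sup_dist M Y x' < d1 \<Longrightarrow>
       hausdorff_less M d1 U T' \<Longrightarrow> \<bar>v x' (insert x' T') - v Y T\<bar> < e"
    using continuous_valueD[OF continuous _ _ e, of Y U] T unfolding TU by blast
  have "W \<notin> insert Y V"
    using WY by (simp add: V_def)
  then obtain d2 where d2: "d2 > 0"
    "\<And>x' T'. x' \<notin> T' \<Longrightarrow> insert x' T' \<in> menus M N \<Longrightarrow> sup_dist M W x' < d2 \<Longrightarrow>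
       hausdorff_less M d2 (insert Y V) T' \<Longrightarrow> \<bar>v x' (insert x' T') - v W T\<bar> < e"
    using continuous_valueD[OF continuous _ _ e, of W "insert Y V"] T unfolding TV by blast
  define c where "c = min d1 d2 / 2"
  have c: "0 < c" "c < d1" "c < d2"
    using d1(1) d2(1) by (auto simp: c_def min_def)
  define Y' where "Y' = Y + cash c"
  have b: "Z \<in> bundles M" if "Z \<in> T" for Z
    using that T by (auto simp: menus_def)
  have "price Y' = price Y + c"
    using price_add_cash b[OF Y] by (simp add: Y'_def)
  then have better: "price Z < price Y'" if "Z \<in> T" for Z
    using max[OF that] c(1) by simp
  from this[of Y'] have Y'T: "Y' \<notin> T"
    by auto
  define T' where "T' = insert Y' U"
  have T'W: "T' = insert W (insert Y' V)"
    using WT WY by (auto simp: T'_def U_def V_def)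
  have finT: "finite T" "enat (card T) \<le> N"
    using T by (auto simp: menus_def)
  have "card T' = card T"
    using finT(1) Y Y'T card_Suc_Diff1[OF finT(1) Y] by (simp add: T'_def U_def)
  moreover have "Y' \<in> bundles M"
    using b[OF Y] by (simp add: Y'_def bundles_closed)
  ultimately have T': "T' \<in> menus M N"
    using finT b by (auto simp: menus_def T'_def U_def)
  have dist: "sup_dist M Y Y' = c" "sup_dist M Z Z = 0" for Z :: "'w \<Rightarrow> real ^ 'g"
    using c(1) not_empty by (simp_all add: Y'_def sup_dist_add_sure sup_dist_self)
  have "hausdorff_less M d1 U U"
    using not_empty d1(1) by (rule hausdorff_less_refl)
  then have "\<bar>v Y' T' - v Y T\<bar> < e"
    using d1(2)[of Y' U] Y'T T' c by (simp add: T'_def U_def dist)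
  moreover have "hausdorff_less M d2 (insert Y V) (insert Y' V)"
    using c(3) dist(1) not_empty d2(1) by (intro hausdorff_less_insert hausdorff_less_refl) simp_all
  then have "\<bar>v W T' - v W T\<bar> < e"
    using d2(2)[of W "insert Y' V"] Y'T T' WT d2(1)
    unfolding T'W[symmetric] by (auto simp: V_def dist)
  ultimately have "v Y' T' < v W T'"
    using e_def by argo
  moreover have "W \<in> T'"
    using T'W by simp
  ultimately have "Y' \<notin> choice v T'"
    by (auto simp: mem_choice not_le)
  moreover obtain Z where Z: "Z \<in> choice v T'"
    using menu_choice_nonempty[OF T'] by blast
  \<comment> \<open>What is chosen from \<open>T'\<close> is an old option, although
    \<open>Y'\<close> has a strictly higher price than all of these.\<close>
  ultimately have "Z \<in> T"
    by (auto simp: mem_choice T'_def U_def)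
  moreover have "price Y' \<le> price Z"
    using chosen_maximizes_price[OF T' Z] by (simp add: T'_def)
  ultimately show False
    using better[of Z] by simp
qed

lemma price_represents: "utility_representation (menus M N) (choice v) price"
  unfolding utility_representation_def
proof (intro ballI set_eqI iffI)
  fix S X
  assume S: "S \<in> menus M N" and X: "X \<in> choice v S"
  then show "X \<in> argmax_set price S"
    using chosen_maximizes_price[OF S X] X by (simp add: mem_argmax_set mem_choice)
next
  fix S X
  assume S: "S \<in> menus M N" and "X \<in> argmax_set price S"
  then show "X \<in> choice v S"
    by (intro price_maximizer_chosen) (simp_all add: mem_argmax_set)
qed

end

text \<open>On \<open>S'\<close> nothing exceeds \<open>Y\<close>, and on \<open>S\<close> nothing
  exceeds \<open>X\<close>, in particular not \<open>Y\<close>; so \<open>X\<close> is a maximiser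
  on \<open>S'\<close> too.\<close>

lemma utility_representation_imp_warp:
  assumes "utility_representation D C P"
  shows "warp D C"
proof -
  have "X \<in> C S'"
    if "S \<in> D" "S' \<in> D" "X \<in> S \<inter> S'" "Y \<in> S \<inter> S'" "X \<in> C S" "Y \<in> C S'" for S S' X Y
  proof -
    have "P Z \<le> P X" if "Z \<in> S'" for Z
    proof -
      have "P Z \<le> P Y" "P Y \<le> P X"
        using assms \<open>S \<in> D\<close> \<open>S' \<in> D\<close> \<open>X \<in> C S\<close> \<open>Y \<in> C S'\<close> \<open>Y \<in> S \<inter> S'\<close> that
        by (simp_all add: utility_representation_def mem_argmax_set)
      then show ?thesis
        by (rule order_trans)
    qed
    then show ?thesis
      using assms that by (simp add: utility_representation_def mem_argmax_set)
  qed
  then show ?thesis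
    unfolding warp_def by blast
qed

theorem proposition2:
  fixes M :: "'w measure"
    and money :: "'g::finite"
    and N :: enat
    and v :: "('w \<Rightarrow> real ^ 'g) \<Rightarrow> ('w \<Rightarrow> real ^ 'g) set \<Rightarrow> real"
  assumes "prob_space M"
    and "3 \<le> N"
    and "continuous_value M N v"
    and "money_monotone M money N v"
    and "money_nonsatiated M money N v"
    and "max_price_gap M money N v = 0"
  shows "warp (menus M N) (choice v) \<and>
    (\<exists>P :: ('w \<Rightarrow> real ^ 'g) \<Rightarrow> real.
       utility_representation (menus M N) (choice v) P \<and>
       (\<forall>X\<in>bundles M. ereal (P X) = buying_price M money N v X 0) \<and>
       (\<forall>X\<in>bundles M. \<forall>Y\<in>bundles M. P (X + Y) = P X + P Y))"
proof -
  interpret prob_space M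
    by fact
  interpret zero_price_gap M money N v
    by unfold_locales fact+
  show ?thesis
    using utility_representation_imp_warp[OF price_represents] price_represents price_add
      prices_eq(1)[OF _ bundles_zero]
    by (intro conjI exI[of _ price] ballI) simp_all
qed

end
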